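(* Let $R$ be a commutative unital ring with $0\neq 1$, let $E$ be an algebraically closed field which is an $R$-algebra, and let $(D,S)$ be a multiplicative summation on $R$ to $E$. Then the univalent extension $(\mathcal{U}D,\mathcal{U}S)$ of $(D,S)$ is the multiplicative fulfillment of $(D,S)$.
   Context: A multiplicative summation on $R$ to $E$ is a pair $(D,S)$ where $R[\sigma]\subseteq D\subseteq R[[\sigma]]$, $D$ is an $R$-subalgebra of the formal power series ring $R[[\sigma]]$, $S:D\to E$ is a (unital) $R$-algebra homomorphism, $(1-\sigma)D\subseteq D$, and $S$ vanishes on $(1-\sigma)D$. Write $\mathbf{MS}(R,E)$ for the set of these. $(D',S')$ extends $(D,S)$ if $D\subseteq D'$ and $S'|_D=S$; all extensions are in $\mathbf{MS}(R,E)$. Two elements of $\mathbf{MS}(R,E)$ are multiplicatively compatible if they have a common extension in $\mathbf{MS}(R,E)$. An extension of $S$ is multiplicatively $S$-canonical if it is multiplicatively compatible with every extension of $S$. The multiplicative fulfillment of $S$ is its unique maximal multiplicatively $S$-canonical extension. Scalar polynomials. For $P(T)=\sum_k P_kT^k\in D[T]$ put $S(P)(t)=\sum_k S(P_k)t^k\in E[t]$. For $X\in R[[\sigma]]$ let $\mathrm{A}(X;S)=\{P(T)\in D[T] : P(X)=0,\ S(P)(t)\neq 0\}$. A polynomial $P\in \mathrm{A}(X;S)$ for which $\deg S(P)(t)$ is minimal is called $S$-minimal for $X$. The scalar polynomial $s_X(t)\in E[t]$ of $X$ over $S$ is $0$ if $\mathrm{A}(X;S)=\emptyset$; otherwise it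 is the unique monic polynomial which is a nonzero scalar multiple of $S(P)(t)$ for some (equivalently every) $S$-minimal $P$ for $X$. $X$ is $S$-algebraic if $s_X(t)$ is nonconstant, and absolutely $S$-algebraic if it is $S'$-algebraic for every extension $S'$ of $S$ (including $S$ itself). $X$ is absolutely $S$-univalent with root $\rho_X$ if it is absolutely $S$-algebraic and $s_X(t)=(t-\rho_X)^m$ for some $\rho_X\in E$ and $m>0$. Univalent extension: $\mathcal{U}D$ is the set of absolutely $S$-univalent series $X\in R[[\sigma]]$, and $\mathcal{U}S:\mathcal{U}D\to E$ is $X\mapsto\rho_X$. *)

theory Defs
  imports "HOL-Library.FuncSet" "HOL-Computational_Algebra.Computational_Algebra"
begin

locale comm_algebra = module scale
  for scale :: "'r::comm_ring_1 \<Rightarrow> 'e::comm_ring_1 \<Rightarrow> 'e" +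
  assumes scale_mult_left: "scale r (x * y) = scale r x * y"

text \<open>The power series variable is \<^const>\<open>fps_X\<close>, and the scalar action of the base ring
  on power series is multiplication by constant series.\<close>

definition fps_subalgebra :: "'r::comm_ring_1 fps set \<Rightarrow> bool" where
  "fps_subalgebra D \<longleftrightarrow>
     0 \<in> D \<and> 1 \<in> D \<and>
     (\<forall>x\<in>D. \<forall>y\<in>D. x + y \<in> D \<and> x * y \<in> D) \<and>
     (\<forall>r. \<forall>x\<in>D. fps_const r * x \<in> D)"

definition fps_algebra_hom_on ::
    "('r::comm_ring_1 \<Rightarrow> 'e::comm_ring_1 \<Rightarrow> 'e) \<Rightarrow> 'r fps set \<Rightarrow> ('r fps \<Rightarrow> 'e) \<Rightarrow> bool" where
  "fps_algebra_hom_on scale D S \<longleftrightarrow>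
     S 1 = 1 \<and>
     (\<forall>x\<in>D. \<forall>y\<in>D. S (x + y) = S x + S y \<and> S (x * y) = S x * S y) \<and>
     (\<forall>r. \<forall>x\<in>D. S (fps_const r * x) = scale r (S x))"

text \<open>A function \<open>S\<close> with domain \<open>D\<close> is represented by a total function that is
  \<^const>\<open>undefined\<close> outside \<open>D\<close>, so that equality of pairs \<open>(D, S)\<close> is the intended one.\<close>

definition mult_summation ::
    "('r::comm_ring_1 \<Rightarrow> 'e::comm_ring_1 \<Rightarrow> 'e) \<Rightarrow> 'r fps set \<Rightarrow> ('r fps \<Rightarrow> 'e) \<Rightarrow> bool" where
  "mult_summation scale D S \<longleftrightarrow>
     S \<in> extensional D \<and>
     range fps_of_poly \<subseteq> D \<and>
     fps_subalgebra D \<and>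
     fps_algebra_hom_on scale D S \<and>
     (\<forall>x\<in>D. (1 - fps_X) * x \<in> D) \<and>
     (\<forall>x\<in>D. S ((1 - fps_X) * x) = 0)"

text \<open>\<open>mult_extension scale D S D' S'\<close>: the pair \<open>(D', S')\<close> extends \<open>(D, S)\<close>.\<close>

definition mult_extension ::
    "('r::comm_ring_1 \<Rightarrow> 'e::comm_ring_1 \<Rightarrow> 'e) \<Rightarrow>
     'r fps set \<Rightarrow> ('r fps \<Rightarrow> 'e) \<Rightarrow> 'r fps set \<Rightarrow> ('r fps \<Rightarrow> 'e) \<Rightarrow> bool" where
  "mult_extension scale D S D' S' \<longleftrightarrow>
     mult_summation scale D S \<and> mult_summation scale D' S' \<and>
     D \<subseteq> D' \<and> (\<forall>x\<in>D. S' x = S x)"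

definition mult_compatible ::
    "('r::comm_ring_1 \<Rightarrow> 'e::comm_ring_1 \<Rightarrow> 'e) \<Rightarrow>
     'r fps set \<Rightarrow> ('r fps \<Rightarrow> 'e) \<Rightarrow> 'r fps set \<Rightarrow> ('r fps \<Rightarrow> 'e) \<Rightarrow> bool" where
  "mult_compatible scale D S D' S' \<longleftrightarrow>
     (\<exists>D'' S''. mult_extension scale D S D'' S'' \<and> mult_extension scale D' S' D'' S'')"

definition mult_canonical ::
    "('r::comm_ring_1 \<Rightarrow> 'e::comm_ring_1 \<Rightarrow> 'e) \<Rightarrow>
     'r fps set \<Rightarrow> ('r fps \<Rightarrow> 'e) \<Rightarrow> 'r fps set \<Rightarrow> ('r fps \<Rightarrow> 'e) \<Rightarrow> bool" where
  "mult_canonical scale D S D' S' \<longleftrightarrow>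
     mult_extension scale D S D' S' \<and>
     (\<forall>D'' S''. mult_extension scale D S D'' S'' \<longrightarrow> mult_compatible scale D' S' D'' S'')"

definition maximal_mult_canonical ::
    "('r::comm_ring_1 \<Rightarrow> 'e::comm_ring_1 \<Rightarrow> 'e) \<Rightarrow>
     'r fps set \<Rightarrow> ('r fps \<Rightarrow> 'e) \<Rightarrow> 'r fps set \<Rightarrow> ('r fps \<Rightarrow> 'e) \<Rightarrow> bool" where
  "maximal_mult_canonical scale D S D' S' \<longleftrightarrow>
     mult_canonical scale D S D' S' \<and>
     (\<forall>D'' S''. mult_canonical scale D S D'' S'' \<and> mult_extension scale D' S' D'' S'' \<longrightarrow>
        (D'', S'') = (D', S'))"

definition is_mult_fulfillment ::
    "('r::comm_ring_1 \<Rightarrow> 'e::comm_ring_1 \<Rightarrow> 'e) \<Rightarrow>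
     'r fps set \<Rightarrow> ('r fps \<Rightarrow> 'e) \<Rightarrow> 'r fps set \<Rightarrow> ('r fps \<Rightarrow> 'e) \<Rightarrow> bool" where
  "is_mult_fulfillment scale D S F T \<longleftrightarrow>
     maximal_mult_canonical scale D S F T \<and>
     (\<forall>D' S'. maximal_mult_canonical scale D S D' S' \<longrightarrow> (D', S') = (F, T))"

text \<open>The polynomial \<open>S(P)\<close> is \<^term>\<open>map_poly S P\<close>.\<close>

definition annihilators ::
    "'r::comm_ring_1 fps set \<Rightarrow> ('r fps \<Rightarrow> 'e::field) \<Rightarrow> 'r fps \<Rightarrow> 'r fps poly set" where
  "annihilators D S X = {P. (\<forall>k. coeff P k \<in> D) \<and> poly P X = 0 \<and> map_poly S P \<noteq> 0}"

definition S_minimal ::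
    "'r::comm_ring_1 fps set \<Rightarrow> ('r fps \<Rightarrow> 'e::field) \<Rightarrow> 'r fps \<Rightarrow> 'r fps poly \<Rightarrow> bool" where
  "S_minimal D S X P \<longleftrightarrow>
     P \<in> annihilators D S X \<and>
     (\<forall>Q\<in>annihilators D S X. degree (map_poly S P) \<le> degree (map_poly S Q))"

text \<open>The description below determines the polynomial: if \<open>P\<close> and \<open>Q\<close> are minimal and \<open>n\<close> is
  the common degree of their images under \<open>S\<close>, then
  \<open>smult (coeff Q n) P - smult (coeff P n) Q\<close> has coefficients in \<open>D\<close>, annihilates \<open>X\<close>, and its
  image has zero \<open>n\<close>-th coefficient. By minimality the image is zero, so the images of \<open>P\<close>
  and \<open>Q\<close> are proportional.\<close>

definition scalar_poly ::
    "'r::comm_ring_1 fps set \<Rightarrow> ('r fps \<Rightarrow> 'e::field) \<Rightarrow> 'r fps \<Rightarrow> 'e poly" where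
  "scalar_poly D S X =
     (if annihilators D S X = {} then 0
      else (THE s. lead_coeff s = 1 \<and>
                   (\<exists>P c. S_minimal D S X P \<and> c \<noteq> 0 \<and> s = smult c (map_poly S P))))"

definition S_algebraic ::
    "'r::comm_ring_1 fps set \<Rightarrow> ('r fps \<Rightarrow> 'e::field) \<Rightarrow> 'r fps \<Rightarrow> bool" where
  "S_algebraic D S X \<longleftrightarrow> degree (scalar_poly D S X) > 0"

definition abs_algebraic ::
    "('r::comm_ring_1 \<Rightarrow> 'e::field \<Rightarrow> 'e) \<Rightarrow> 'r fps set \<Rightarrow> ('r fps \<Rightarrow> 'e) \<Rightarrow> 'r fps \<Rightarrow> bool" where
  "abs_algebraic scale D S X \<longleftrightarrow>
     (\<forall>D' S'. mult_extension scale D S D' S' \<longrightarrow> S_algebraic D' S' X)"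

definition abs_univalent_root ::
    "('r::comm_ring_1 \<Rightarrow> 'e::field \<Rightarrow> 'e) \<Rightarrow> 'r fps set \<Rightarrow> ('r fps \<Rightarrow> 'e) \<Rightarrow>
     'r fps \<Rightarrow> 'e \<Rightarrow> bool" where
  "abs_univalent_root scale D S X \<rho> \<longleftrightarrow>
     abs_algebraic scale D S X \<and> (\<exists>m>0. scalar_poly D S X = [:- \<rho>, 1:] ^ m)"

definition univalent_dom ::
    "('r::comm_ring_1 \<Rightarrow> 'e::field \<Rightarrow> 'e) \<Rightarrow> 'r fps set \<Rightarrow> ('r fps \<Rightarrow> 'e) \<Rightarrow> 'r fps set" where
  "univalent_dom scale D S = {X. \<exists>\<rho>. abs_univalent_root scale D S X \<rho>}"

definition univalent_sum ::
    "('r::comm_ring_1 \<Rightarrow> 'e::field \<Rightarrow> 'e) \<Rightarrow> 'r fps set \<Rightarrow> ('r fps \<Rightarrow> 'e) \<Rightarrow> 'r fps \<Rightarrow> 'e" where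
  "univalent_sum scale D S =
     restrict (\<lambda>X. THE \<rho>. abs_univalent_root scale D S X \<rho>) (univalent_dom scale D S)"

end

theory Submission imports Defs begin

text \<open>Every extension of \<open>(D, S)\<close> lies below a maximal one by Zorn's lemma, and the scalar
  polynomial of \<open>X\<close> divides \<open>S(P)\<close> for all \<open>P \<in> D[T]\<close> with \<open>P(X) = 0\<close>, so its roots are exactly
  the values that an extension of \<open>S\<close> can take at \<open>X\<close>. Hence \<open>X\<close> is absolutely univalent with
  root \<open>\<rho>\<close> iff every maximal extension of \<open>S\<close> is defined at \<open>X\<close> with value \<open>\<rho>\<close>: the univalent
  extension is the common part of the maximal extensions. Since an extension compatible with
  a maximal one lies below it, this common part is the largest canonical extension.\<close>

section \<open>Summations and the order of extension\<close>

lemma mult_summationD: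
  assumes "mult_summation scale D S"
  shows "S \<in> extensional D" "fps_of_poly p \<in> D" "0 \<in> D" "1 \<in> D" "fps_const r \<in> D"
    "\<And>x y. x \<in> D \<Longrightarrow> y \<in> D \<Longrightarrow> x + y \<in> D"
    "\<And>x y. x \<in> D \<Longrightarrow> y \<in> D \<Longrightarrow> x * y \<in> D"
    "\<And>x. x \<in> D \<Longrightarrow> - x \<in> D"
    "\<And>x y. x \<in> D \<Longrightarrow> y \<in> D \<Longrightarrow> S (x + y) = S x + S y"
    "\<And>x y. x \<in> D \<Longrightarrow> y \<in> D \<Longrightarrow> S (x * y) = S x * S y"
    "S 1 = 1" "S 0 = 0"
    "\<And>x. x \<in> D \<Longrightarrow> S (- x) = - S x"
    "S (fps_const r) = scale r 1"
    "S (1 - fps_X) = 0"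
proof -
  note ms = assms[unfolded mult_summation_def fps_subalgebra_def fps_algebra_hom_on_def]
  show "S \<in> extensional D" "fps_of_poly p \<in> D" "0 \<in> D" and one: "1 \<in> D"
    and "\<And>x y. x \<in> D \<Longrightarrow> y \<in> D \<Longrightarrow> x + y \<in> D"
    and "\<And>x y. x \<in> D \<Longrightarrow> y \<in> D \<Longrightarrow> x * y \<in> D"
    and Sadd: "\<And>x y. x \<in> D \<Longrightarrow> y \<in> D \<Longrightarrow> S (x + y) = S x + S y"
    and "\<And>x y. x \<in> D \<Longrightarrow> y \<in> D \<Longrightarrow> S (x * y) = S x * S y"
    and S1: "S 1 = 1"
    using ms by auto
  have const: "fps_const r * x \<in> D" "S (fps_const r * x) = scale r (S x)" if "x \<in> D" for r x
    using ms that by auto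
  show "fps_const r \<in> D" "S (fps_const r) = scale r 1"
    using const[OF one, of r] S1 by simp_all
  have "(1 - fps_X) * (1 :: 'a fps) \<in> D" "S ((1 - fps_X) * 1) = 0"
    using ms one by blast+
  then show "S (1 - fps_X) = 0" by simp
  \<comment> \<open>Every later computation of coefficients of \<open>map_poly S P\<close> rests on
    \<open>S 0 = 0\<close>, a side condition of \<open>coeff_map_poly\<close>.\<close>
  have "S (0 + 0) = S 0 + S 0"
    using ms by blast
  then show S0: "S 0 = 0" by simp
  show neg: "- x \<in> D" if "x \<in> D" for x
    using const(1)[OF that, of "-1"] by (simp flip: fps_const_neg)
  show "S (- x) = - S x" if "x \<in> D" for x
    using Sadd[OF that neg[OF that]] S0 by (simp add: eq_neg_iff_add_eq_0 add.commute)
qed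

text \<open>A ring homomorphism extending \<open>S\<close> is already a summation: the scalar action
  is multiplication by constants, and these as well as \<open>1 - fps_X\<close> lie in
  \<open>D\<close>, where \<open>S\<close> is known. So only sums and products need
  checking.\<close>

lemma mult_extensionI:
  assumes "comm_algebra scale" and ms: "mult_summation scale D S"
    and "D \<subseteq> D'" "S' \<in> extensional D'" and agree: "\<And>x. x \<in> D \<Longrightarrow> S' x = S x"
    and closed: "\<And>x y. x \<in> D' \<Longrightarrow> y \<in> D' \<Longrightarrow> x + y \<in> D'"
      "\<And>x y. x \<in> D' \<Longrightarrow> y \<in> D' \<Longrightarrow> x * y \<in> D'"
    and hom: "\<And>x y. x \<in> D' \<Longrightarrow> y \<in> D' \<Longrightarrow> S' (x + y) = S' x + S' y"
      "\<And>x y. x \<in> D' \<Longrightarrow> y \<in> D' \<Longrightarrow> S' (x * y) = S' x * S' y"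
  shows "mult_extension scale D S D' S'"
proof -
  note D = mult_summationD[OF ms]
  have scale: "scale r y = scale r 1 * y" for r y
    using comm_algebra.scale_mult_left[OF assms(1), of r 1 y] by simp
  have sub: "x \<in> D'" if "x \<in> D" for x
    using that assms(3) by blast
  have "fps_of_poly [:1, -1:] = (1 - fps_X :: 'a fps)"
    by (simp add: fps_of_poly_pCons)
  then have X: "1 - fps_X \<in> D"
    using D(2) by metis
  have const: "fps_const r * x \<in> D'" "S' (fps_const r * x) = scale r (S' x)" if "x \<in> D'" for r x
    using closed(2)[OF sub[OF D(5)] that] hom(2)[OF sub[OF D(5)] that] agree[OF D(5)]
      D(14) scale[of r "S' x"] by simp_all
  have vanish: "(1 - fps_X) * x \<in> D'" "S' ((1 - fps_X) * x) = 0" if "x \<in> D'" for x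
    using closed(2)[OF sub[OF X] that] hom(2)[OF sub[OF X] that] agree[OF X] D(15) by simp_all
  have "range fps_of_poly \<subseteq> D'" "0 \<in> D'" "1 \<in> D'" "S' 1 = 1"
    using sub D(2-4,11) agree by auto
  then have "mult_summation scale D' S'"
    unfolding mult_summation_def fps_subalgebra_def fps_algebra_hom_on_def
    by (intro conjI ballI allI) (use assms(4) closed hom const vanish in simp_all)
  then show ?thesis
    unfolding mult_extension_def using ms assms(3) agree by blast
qed

lemma mult_extension_refl: "mult_summation scale D S \<Longrightarrow> mult_extension scale D S D S"
  by (simp add: mult_extension_def)

lemma mult_extension_trans:
  "mult_extension scale D S D' S' \<Longrightarrow> mult_extension scale D' S' D'' S'' \<Longrightarrow>
    mult_extension scale D S D'' S''"
  unfolding mult_extension_def by (metis subset_eq)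

lemma mult_extension_antisym:
  assumes "mult_extension scale D S D' S'" "mult_extension scale D' S' D S"
  shows "D' = D \<and> S' = S"
  using assms unfolding mult_extension_def mult_summation_def
  by (metis extensionalityI subset_antisym)

section \<open>Simple extensions\<close>

lemma hom_sum:
  assumes "mult_summation scale D S" "\<And>i. i \<in> A \<Longrightarrow> f i \<in> D"
  shows "sum f A \<in> D \<and> S (sum f A) = (\<Sum>i\<in>A. S (f i))"
  using assms(2)
  by (induction A rule: infinite_finite_induct) (simp_all add: mult_summationD[OF assms(1)])

text \<open>\<open>S\<close> respects the ring operations only on \<open>D\<close>, so membership of
  all coefficients is tracked along with each identity.\<close>

lemma map_poly_hom:
  assumes ms: "mult_summation scale D S" and "\<forall>k. coeff P k \<in> D" "\<forall>k. coeff Q k \<in> D"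
  shows "\<forall>k. coeff (P + Q) k \<in> D" "\<forall>k. coeff (P * Q) k \<in> D" "\<forall>k. coeff (- P) k \<in> D"
    "map_poly S (P + Q) = map_poly S P + map_poly S Q"
    "map_poly S (P * Q) = map_poly S P * map_poly S Q"
    "map_poly S (- P) = - map_poly S P"
proof -
  note D = mult_summationD[OF ms]
  have "coeff (P * Q) k \<in> D \<and>
      S (coeff (P * Q) k) = (\<Sum>i\<le>k. S (coeff P i) * S (coeff Q (k - i)))" for k
    unfolding coeff_mult using hom_sum[OF ms, of "{..k}" "\<lambda>i. coeff P i * coeff Q (k - i)"]
    by (simp add: D assms)
  then show "\<forall>k. coeff (P * Q) k \<in> D" "map_poly S (P * Q) = map_poly S P * map_poly S Q"
    by (auto intro!: poly_eqI simp: coeff_map_poly D coeff_mult)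
  show "\<forall>k. coeff (P + Q) k \<in> D" "\<forall>k. coeff (- P) k \<in> D"
    "map_poly S (P + Q) = map_poly S P + map_poly S Q" "map_poly S (- P) = - map_poly S P"
    using assms by (auto intro!: poly_eqI simp: coeff_map_poly D)
qed

lemma map_poly_monom_hom:
  assumes ms: "mult_summation scale D S" and "c \<in> D"
  shows "\<forall>k. coeff (monom c n) k \<in> D" "map_poly S (monom c n) = monom (S c) n"
  using assms by (auto simp: mult_summationD[OF ms] map_poly_monom)

lemma poly_in_dom:
  assumes ms: "mult_summation scale D S" and "\<forall>k. coeff P k \<in> D" "x \<in> D"
  shows "poly P x \<in> D \<and> S (poly P x) = poly (map_poly S P) (S x)"
  using assms(2)
proof (induction P)
  case 0
  then show ?case by (simp add: mult_summationD[OF ms])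
next
  case (pCons a P)
  have "a \<in> D" "\<forall>k. coeff P k \<in> D"
    using pCons.prems by (metis coeff_pCons_0, metis coeff_pCons_Suc)
  then show ?case
    using pCons.IH pCons.hyps \<open>x \<in> D\<close>
    by (simp add: mult_summationD[OF ms] map_poly_pCons)
qed

text \<open>The extension lives on \<open>D[X]\<close> and substitutes \<open>e\<close> for
  \<open>X\<close>. The assumption \<open>wd\<close> makes the value at \<open>poly P X\<close>
  independent of \<open>P\<close>, since two representations differ by a polynomial vanishing at
  \<open>X\<close>.\<close>

lemma simple_extension:
  assumes alg: "comm_algebra scale" and ms: "mult_summation scale D S"
    and wd: "\<And>P. \<forall>k. coeff P k \<in> D \<Longrightarrow> poly P X = 0 \<Longrightarrow> poly (map_poly S P) e = 0"
  shows "\<exists>D' S'. mult_extension scale D S D' S' \<and> X \<in> D' \<and> S' X = e"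
proof -
  define D' where "D' = {poly P X |P. \<forall>k. coeff P k \<in> D}"
  define S' where "S' = restrict (\<lambda>x. poly (map_poly S
      (SOME P. (\<forall>k. coeff P k \<in> D) \<and> poly P X = x)) e) D'"
  note D = mult_summationD[OF ms]
  have S': "poly P X \<in> D'" "S' (poly P X) = poly (map_poly S P) e"
    if P: "\<forall>k. coeff P k \<in> D" for P
  proof -
    show "poly P X \<in> D'"
      using P by (auto simp: D'_def)
    define Q where "Q = (SOME Q. (\<forall>k. coeff Q k \<in> D) \<and> poly Q X = poly P X)"
    have Q: "\<forall>k. coeff Q k \<in> D" "poly Q X = poly P X"
      using someI[of "\<lambda>Q. (\<forall>k. coeff Q k \<in> D) \<and> poly Q X = poly P X" P] P
      by (auto simp: Q_def)
    have "poly (map_poly S (Q + - P)) e = 0"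
      using Q by (intro wd map_poly_hom(1)[OF ms Q(1) map_poly_hom(3)[OF ms P P]]) simp
    then show "S' (poly P X) = poly (map_poly S P) e"
      using \<open>poly P X \<in> D'\<close> Q P map_poly_hom[OF ms P P] map_poly_hom[OF ms Q(1), of "- P"]
      by (simp add: S'_def Q_def)
  qed
  have rep: "\<exists>P. (\<forall>k. coeff P k \<in> D) \<and> x = poly P X" if "x \<in> D'" for x
    using that by (auto simp: D'_def)
  \<comment> \<open>Constant polynomials recover \<open>S\<close> on \<open>D\<close>; further down,
    \<open>monom 1 1\<close> represents \<open>X\<close> itself.\<close>
  have const: "x \<in> D' \<and> S' x = S x" if "x \<in> D" for x
    using S'[of "monom x 0"] map_poly_monom_hom[OF ms that, of 0] by (simp add: poly_monom)
  have extensional: "S' \<in> extensional D'"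
    by (simp add: S'_def)
  have "mult_extension scale D S D' S'"
  proof (rule mult_extensionI[OF alg ms])
    fix x y assume "x \<in> D'" "y \<in> D'"
    then obtain P Q where P: "\<forall>k. coeff P k \<in> D" "x = poly P X"
      and Q: "\<forall>k. coeff Q k \<in> D" "y = poly Q X"
      using rep by metis
    note hom = map_poly_hom[OF ms P(1) Q(1)]
    show "x + y \<in> D'" "S' (x + y) = S' x + S' y"
      using S'[OF hom(1)] S'[OF P(1)] S'[OF Q(1)] by (simp_all add: P Q hom)
    show "x * y \<in> D'" "S' (x * y) = S' x * S' y"
      using S'[OF hom(2)] S'[OF P(1)] S'[OF Q(1)] by (simp_all add: P Q hom)
  qed (use const extensional in auto)
  moreover have "X \<in> D' \<and> S' X = e"
    using S'[of "monom 1 1"] map_poly_monom_hom[OF ms D(4), of 1] by (simp add: poly_monom D)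
  ultimately show ?thesis by blast
qed

section \<open>Scalar polynomials\<close>

text \<open>Euclidean division carried out in \<open>D[T]\<close>: as \<open>D\<close> need not be a
  field, each step cross-multiplies by leading coefficients, and \<open>S\<close> sends the
  multiplier of \<open>Q\<close> to a unit. Polynomials are measured by the degree of their images
  under \<open>S\<close>.\<close>

lemma S_minimal_dvd:
  assumes ms: "mult_summation scale D S" and min: "S_minimal D S X P"
    and "\<forall>k. coeff Q k \<in> D" "poly Q X = 0"
  shows "map_poly S P dvd map_poly S Q"
  using assms(3,4)
proof (induction "degree (map_poly S Q)" arbitrary: Q rule: less_induct)
  case less
  show ?case
  proof (cases "map_poly S Q = 0")
    case False
    have P: "\<forall>k. coeff P k \<in> D" "poly P X = 0" "map_poly S P \<noteq> 0"
      using min by (auto simp: S_minimal_def annihilators_def)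
    note D = mult_summationD[OF ms]
    define n where "n = degree (map_poly S P)"
    define m where "m = degree (map_poly S Q)"
    \<comment> \<open>\<open>c\<close> and \<open>d\<close> sit at the degrees of the images, since
      \<open>S\<close> may kill the leading coefficients of \<open>P\<close> and \<open>Q\<close>
      themselves.\<close>
    define c where "c = coeff P n"
    define d where "d = coeff Q m"
    have "n \<le> m"
      using min less.prems False by (auto simp: S_minimal_def annihilators_def n_def m_def)
    have cd: "c \<in> D" "d \<in> D" "S c = lead_coeff (map_poly S P)" "S d = lead_coeff (map_poly S Q)"
      using P less.prems by (auto simp: c_def d_def n_def m_def coeff_map_poly D)
    have Sc: "S c \<noteq> 0"
      using cd P by simp
    define A where "A = smult c Q"
    define B where "B = monom d (m - n) * P"
    have A: "\<forall>k. coeff A k \<in> D" "map_poly S A = smult (S c) (map_poly S Q)"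
      using less.prems(1) cd(1) by (auto intro!: poly_eqI simp: A_def coeff_map_poly D)
    have B: "\<forall>k. coeff B k \<in> D" "map_poly S B = monom (S d) (m - n) * map_poly S P"
      using map_poly_hom[OF ms map_poly_monom_hom(1)[OF ms cd(2)] P(1)]
        map_poly_monom_hom(2)[OF ms cd(2)]
      by (simp_all add: B_def)
    have R: "\<forall>k. coeff (A + - B) k \<in> D"
      "map_poly S (A + - B) = smult (S c) (map_poly S Q) - monom (S d) (m - n) * map_poly S P"
      using map_poly_hom[OF ms A(1), of "- B"] map_poly_hom[OF ms B(1) B(1)] A B by simp_all
    have "poly (A + - B) X = 0"
      using P less.prems by (simp add: A_def B_def)
    have le: "degree (map_poly S (A + - B)) \<le> m"
      unfolding R
    proof (rule degree_diff_le)
      show "degree (smult (S c) (map_poly S Q)) \<le> m"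
        by (simp add: m_def)
      have "degree (monom (S d) (m - n) * map_poly S P) \<le> (m - n) + n"
        by (rule order_trans[OF degree_mult_le]) (simp add: n_def degree_monom_le)
      then show "degree (monom (S d) (m - n) * map_poly S P) \<le> m"
        using \<open>n \<le> m\<close> by simp
    qed
    have zero: "coeff (map_poly S (A + - B)) m = 0"
      unfolding R using \<open>n \<le> m\<close> cd by (simp add: coeff_monom_mult n_def m_def)
    \<comment> \<open>Cancelling the coefficient at \<open>m\<close> lowers the degree unless the
      image vanishes: the zero polynomial has degree 0, which is no drop when
      \<open>m = 0\<close>.\<close>
    have "map_poly S P dvd map_poly S (A + - B)"
    proof (cases "map_poly S (A + - B) = 0")
      case nz: False
      have "degree (map_poly S (A + - B)) \<noteq> m"
        using zero nz by auto
      then show ?thesis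
        using le R(1) \<open>poly (A + - B) X = 0\<close> by (intro less.hyps) (auto simp: m_def)
    qed simp
    then have "map_poly S P dvd smult (S c) (map_poly S Q)"
      unfolding R by (metis dvd_triv_right dvd_add diff_add_cancel)
    then show ?thesis
      using Sc by (simp add: dvd_smult_iff)
  qed simp
qed

lemma monic_dvd_antisym:
  fixes p q :: "'a::idom poly"
  assumes "p dvd q" "q dvd p" "lead_coeff p = 1" "lead_coeff q = 1"
  shows "p = q"
proof -
  obtain k where k: "q = p * k"
    using assms(1) by blast
  have "p \<noteq> 0" "k \<noteq> 0"
    using assms(3,4) k by auto
  moreover have "degree q \<le> degree p"
    using assms(2) \<open>p \<noteq> 0\<close> by (rule dvd_imp_degree_le)
  ultimately have "degree k = 0"
    by (simp add: k degree_mult_eq)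
  then obtain c where c: "k = [:c:]"
    by (rule degree_eq_zeroE)
  have "lead_coeff q = lead_coeff p * lead_coeff k"
    unfolding k by (rule lead_coeff_mult)
  then have "lead_coeff k = 1"
    by (simp only: assms(3,4) mult_1_left)
  then show ?thesis
    by (simp add: k c)
qed

text \<open>Makes the description in \<open>scalar_poly\<close> usable. Normalising an annihilator
  of least image degree gives existence; the images of two minimal annihilators divide each other,
  so their monic multiples agree.\<close>

lemma scalar_poly_S_minimal:
  assumes ms: "mult_summation scale D S" and "annihilators D S X \<noteq> {}"
  shows "\<exists>P c. S_minimal D S X P \<and> c \<noteq> 0 \<and> scalar_poly D S X = smult c (map_poly S P) \<and>
           lead_coeff (scalar_poly D S X) = 1"
proof -
  let ?Q = "\<lambda>s. lead_coeff s = 1 \<and> (\<exists>P c. S_minimal D S X P \<and> c \<noteq> 0 \<and> s = smult c (map_poly S P))"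
  obtain P where P: "S_minimal D S X P"
    using ex_has_least_nat[of "\<lambda>P. P \<in> annihilators D S X" _ "\<lambda>P. degree (map_poly S P)"] assms(2)
    unfolding S_minimal_def by blast
  have min: "\<forall>k. coeff P k \<in> D" "poly P X = 0" "map_poly S P \<noteq> 0" if "S_minimal D S X P" for P
    using that by (auto simp: S_minimal_def annihilators_def)
  have ex: "?Q (smult (inverse (lead_coeff (map_poly S P))) (map_poly S P))"
    using P min(3)[OF P]
    by (auto intro!: exI[of _ P] exI[of _ "inverse (lead_coeff (map_poly S P))"])
  have unique: "s = s'" if Q: "?Q s" "?Q s'" for s s'
  proof -
    obtain P c P' c' where s: "S_minimal D S X P" "c \<noteq> 0" "s = smult c (map_poly S P)"
      "S_minimal D S X P'" "c' \<noteq> 0" "s' = smult c' (map_poly S P')"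
      using Q by blast
    have "s dvd s'" "s' dvd s"
      using S_minimal_dvd[OF ms] min s by (simp_all add: dvd_smult_iff smult_dvd_iff)
    then show ?thesis
      using Q by (intro monic_dvd_antisym) blast+
  qed
  have "?Q (THE s. ?Q s)"
    by (rule theI[of ?Q]) (use ex unique in blast)+
  then show ?thesis
    using assms(2) by (auto simp: scalar_poly_def)
qed

lemma scalar_poly_dvd:
  assumes ms: "mult_summation scale D S" and "\<forall>k. coeff Q k \<in> D" "poly Q X = 0"
  shows "scalar_poly D S X dvd map_poly S Q"
proof (cases "annihilators D S X = {}")
  case True
  \<comment> \<open>Without annihilators \<open>scalar_poly\<close> has the default value 0, which
    divides only 0; \<open>Q\<close> must then have zero image.\<close>
  then have "map_poly S Q = 0"
    using assms by (auto simp: annihilators_def)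
  then show ?thesis by simp
next
  case False
  then show ?thesis
    using scalar_poly_S_minimal[OF ms False] S_minimal_dvd[OF ms _ assms(2,3)]
    by (auto simp: smult_dvd_iff)
qed

text \<open>A root of the scalar polynomial kills the image of every polynomial over
  \<open>D\<close> vanishing at \<open>X\<close>, so \<open>simple_extension\<close> accepts it as a
  value. Conversely, an extension defined at \<open>X\<close> turns \<open>poly P X = 0\<close> into
  a root of that image. The default 0 fits: every \<open>e\<close> is then a root, and every
  \<open>e\<close> is attained.\<close>

lemma scalar_poly_root_iff:
  assumes alg: "comm_algebra scale" and ms: "mult_summation scale D S"
  shows "poly (scalar_poly D S X) e = 0 \<longleftrightarrow>
    (\<exists>D' S'. mult_extension scale D S D' S' \<and> X \<in> D' \<and> S' X = e)"
proof
  assume "poly (scalar_poly D S X) e = 0"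
  then show "\<exists>D' S'. mult_extension scale D S D' S' \<and> X \<in> D' \<and> S' X = e"
    using scalar_poly_dvd[OF ms] by (intro simple_extension[OF alg ms]) (metis dvdE mult_zero_left poly_mult)
next
  assume "\<exists>D' S'. mult_extension scale D S D' S' \<and> X \<in> D' \<and> S' X = e"
  then obtain D' S' where ext: "mult_extension scale D S D' S'" "X \<in> D'" "S' X = e"
    by blast
  show "poly (scalar_poly D S X) e = 0"
  proof (cases "annihilators D S X = {}")
    case False
    obtain P c where P: "S_minimal D S X P" "scalar_poly D S X = smult c (map_poly S P)"
      using scalar_poly_S_minimal[OF ms False] by blast
    have D: "\<forall>k. coeff P k \<in> D" "poly P X = 0"
      using P by (auto simp: S_minimal_def annihilators_def)
    have ms': "mult_summation scale D' S'" and "\<forall>k. coeff P k \<in> D'"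
      and agree: "\<And>x. x \<in> D \<Longrightarrow> S' x = S x"
      using ext D by (auto simp: mult_extension_def)
    then have "S' (poly P X) = poly (map_poly S' P) e"
      using poly_in_dom ext by blast
    moreover have "map_poly S' P = map_poly S P"
      using agree D by (intro poly_eqI)
        (simp add: coeff_map_poly mult_summationD[OF ms] mult_summationD[OF ms'])
    ultimately show ?thesis
      using P D by (simp add: mult_summationD[OF ms'])
  qed (simp add: scalar_poly_def)
qed

section \<open>Maximal extensions\<close>

text \<open>Maximality is tested against extensions of \<open>(M, T)\<close>, which by transitivity
  are extensions of \<open>(D, S)\<close> as well.\<close>

definition maximal_extension where
  "maximal_extension scale D S M T \<longleftrightarrow> mult_extension scale D S M T \<and>
     (\<forall>D' S'. mult_extension scale M T D' S' \<longrightarrow> D' = M \<and> S' = T)"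

text \<open>Zorn's lemma on pairs of domain and function. The empty chain is bounded by
  \<open>(D, S)\<close>, any other chain by its union.\<close>

lemma maximal_extension_exists:
  assumes alg: "comm_algebra scale" and ms: "mult_summation scale D S"
  shows "\<exists>M T. maximal_extension scale D S M T"
proof -
  let ?A = "{p. mult_extension scale D S (fst p) (snd p)}"
  let ?P = "\<lambda>p q. mult_extension scale (fst p) (snd p) (fst q) (snd q)"
  have "\<exists>m\<in>?A. \<forall>a\<in>?A. ?P m a \<longrightarrow> a = m"
  proof (rule predicate_Zorn)
    show "partial_order_on ?A (relation_of ?P ?A)"
    proof (rule partial_order_on_relation_ofI)
      show "?P a a" if "a \<in> ?A" for a
        using that by (auto simp: mult_extension_def)
      show "?P a c" if "?P a b" "?P b c" for a b c
        using that by (rule mult_extension_trans)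
      show "a = b" if "?P a b" "?P b a" for a b
        using mult_extension_antisym[OF that] by (simp add: prod_eq_iff)
    qed
  next
    fix C assume chain: "C \<in> Chains (relation_of ?P ?A)"
    show "\<exists>u\<in>?A. \<forall>a\<in>C. ?P a u"
    proof (cases "C = {}")
      case True
      then show ?thesis
        using mult_extension_refl[OF ms] by (intro bexI[of _ "(D, S)"]) auto
    next
      case False
      have CA: "?P (D, S) p" if "p \<in> C" for p
        using chain that by (auto simp: Chains_def relation_of_def)
      have tot: "?P p q \<or> ?P q p" if "p \<in> C" "q \<in> C" for p q
        using chain that by (auto simp: Chains_def relation_of_def)
      define U where "U = \<Union> (fst ` C)"
      define T where "T = restrict (\<lambda>x. snd (SOME p. p \<in> C \<and> x \<in> fst p) x) U"
      \<comment> \<open>The values glue because comparable members agree where both are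
        defined.\<close>
      have T: "T x = snd p x" if "p \<in> C" "x \<in> fst p" for p x
      proof -
        define q where "q = (SOME p. p \<in> C \<and> x \<in> fst p)"
        have q: "q \<in> C" "x \<in> fst q"
          using someI[of "\<lambda>p. p \<in> C \<and> x \<in> fst p" p] that by (auto simp: q_def)
        have "T x = snd q x"
          using that by (auto simp: T_def U_def q_def)
        also have "\<dots> = snd p x"
          using tot[OF q(1) that(1)] q(2) that(2) by (auto simp: mult_extension_def)
        finally show ?thesis .
      qed
      \<comment> \<open>Totality puts two points of \<open>U\<close> into a single member, which
        reduces closure and the homomorphism laws to that member.\<close>
      have pair: "\<exists>p\<in>C. x \<in> fst p \<and> y \<in> fst p" if xy: "x \<in> U" "y \<in> U" for x y
      proof -
        obtain p q where "p \<in> C" "q \<in> C" "x \<in> fst p" "y \<in> fst q"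
          using xy by (auto simp: U_def)
        then show ?thesis
          using tot[of p q] unfolding mult_extension_def by blast
      qed
      have ext: "mult_extension scale (fst p) (snd p) U T" if p: "p \<in> C" for p
      proof (rule mult_extensionI[OF alg])
        show "mult_summation scale (fst p) (snd p)"
          using CA[OF p] by (simp add: mult_extension_def)
        show "fst p \<subseteq> U" "T \<in> extensional U"
          using p by (auto simp: U_def T_def)
        show "T x = snd p x" if "x \<in> fst p" for x
          using T p that by blast
        fix x y assume "x \<in> U" "y \<in> U"
        then obtain q where q: "q \<in> C" "x \<in> fst q" "y \<in> fst q"
          using pair by blast
        have "mult_summation scale (fst q) (snd q)"
          using CA[OF q(1)] by (simp add: mult_extension_def)
        note Q = mult_summationD[OF this]
        have closed: "x + y \<in> fst q" "x * y \<in> fst q"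
          by (rule Q(6,7)[OF q(2,3)])+
        then show "x + y \<in> U" "x * y \<in> U"
          using q(1) by (auto simp: U_def)
        show "T (x + y) = T x + T y" "T (x * y) = T x * T y"
          using Q(9,10)[OF q(2,3)] by (simp_all add: T[OF q(1)] closed q)
      qed
      obtain p where "p \<in> C"
        using False by blast
      then have "(U, T) \<in> ?A"
        using mult_extension_trans[OF CA[of p, simplified] ext[of p]] by simp
      then show ?thesis
        using ext by (intro bexI[of _ "(U, T)"]) auto
    qed
  qed
  then obtain m where m: "?P (D, S) m" and max: "\<And>a. ?P (D, S) a \<Longrightarrow> ?P m a \<Longrightarrow> a = m"
    by auto
  have "D' = fst m \<and> S' = snd m" if "mult_extension scale (fst m) (snd m) D' S'" for D' S'
    using max[of "(D', S')"] m mult_extension_trans[of scale D S "fst m" "snd m" D' S'] that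
    by auto
  then have "maximal_extension scale D S (fst m) (snd m)"
    using m by (simp add: maximal_extension_def)
  then show ?thesis by blast
qed

text \<open>The maximality clause does not mention \<open>(D, S)\<close>, so a maximal extension of
  \<open>(D', S')\<close> is also one of \<open>(D, S)\<close>.\<close>

lemma maximal_extension_above:
  assumes alg: "comm_algebra scale" and ext: "mult_extension scale D S D' S'"
  shows "\<exists>M T. maximal_extension scale D S M T \<and> mult_extension scale D' S' M T"
proof -
  have "mult_summation scale D' S'"
    using ext by (simp add: mult_extension_def)
  from maximal_extension_exists[OF alg this]
  obtain M T where M: "mult_extension scale D' S' M T"
    and max: "\<forall>D' S'. mult_extension scale M T D' S' \<longrightarrow> D' = M \<and> S' = T"
    unfolding maximal_extension_def by (elim exE conjE)
  have "maximal_extension scale D S M T"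
    unfolding maximal_extension_def using mult_extension_trans[OF ext M] max by (rule conjI)
  with M show ?thesis by (intro exI conjI)
qed

section \<open>Univalence in terms of maximal extensions\<close>

lemma poly_single_root:
  fixes p :: "'a::alg_closed_field poly"
  assumes "lead_coeff p = 1" "poly p \<rho> = 0" "\<And>e. poly p e = 0 \<Longrightarrow> e = \<rho>"
  shows "\<exists>m>0. p = [:- \<rho>, 1:] ^ m"
proof -
  have "p \<noteq> 0"
    using assms(1) by auto
  then obtain q where "p = [:- \<rho>, 1:] ^ order \<rho> p * q" and ndvd: "\<not> [:- \<rho>, 1:] dvd q"
    using order_decomp by blast
  then obtain m where p: "p = [:- \<rho>, 1:] ^ m * q"
    by blast
  \<comment> \<open>A root of \<open>q\<close> is a root of \<open>p\<close>, hence \<rho>; but all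
    factors \<open>[:- \<rho>, 1:]\<close> have been split off. Over an algebraically closed field
    \<open>q\<close> is therefore constant.\<close>
  have "poly q e \<noteq> 0" for e
  proof
    assume "poly q e = 0"
    then have "e = \<rho>"
      using assms(3)[of e] by (simp add: p)
    then show False
      using \<open>poly q e = 0\<close> ndvd by (simp add: poly_eq_0_iff_dvd)
  qed
  then have "degree q = 0"
    using alg_closed_imp_poly_has_root[of q] by blast
  then obtain c where q: "q = [:c:]"
    by (rule degree_eq_zeroE)
  have "lead_coeff p = c"
    by (simp only: p lead_coeff_mult lead_coeff_power) (simp add: q)
  then have "c = 1"
    by (simp only: assms(1))
  then have "p = [:- \<rho>, 1:] ^ m"
    by (simp add: p q)
  moreover have "m \<noteq> 0"
    using assms(2) calculation by (auto intro: ccontr)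
  ultimately show ?thesis by blast
qed

text \<open>Over a maximal extension the scalar polynomial is nonconstant, so it has a root; some
  further extension takes that root at \<open>X\<close>, and maximality puts \<open>X\<close> into
  \<open>M\<close> already. Conversely, each root over an extension is the value at \<open>X\<close>
  of a maximal extension above it, so \<rho> is the only root.\<close>

lemma abs_univalent_root_iff:
  fixes scale :: "'r::comm_ring_1 \<Rightarrow> 'e::alg_closed_field \<Rightarrow> 'e"
  assumes alg: "comm_algebra scale" and ms: "mult_summation scale D S"
  shows "abs_univalent_root scale D S X \<rho> \<longleftrightarrow>
    (\<forall>M T. maximal_extension scale D S M T \<longrightarrow> X \<in> M \<and> T X = \<rho>)"
proof (intro iffI allI impI)
  fix M T
  assume X: "abs_univalent_root scale D S X \<rho>" and "maximal_extension scale D S M T"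
  then have ext: "mult_extension scale D S M T"
    and max: "\<And>D' S'. mult_extension scale M T D' S' \<Longrightarrow> D' = M \<and> S' = T"
    by (auto simp: maximal_extension_def)
  have ms': "mult_summation scale M T"
    using ext by (simp add: mult_extension_def)
  have "degree (scalar_poly M T X) > 0"
    using X ext by (auto simp: abs_univalent_root_def abs_algebraic_def S_algebraic_def)
  then obtain e where "poly (scalar_poly M T X) e = 0"
    using alg_closed_imp_poly_has_root by blast
  then have "X \<in> M"
    using scalar_poly_root_iff[OF alg ms'] max by blast
  \<comment> \<open>The value is compared over \<open>(D, S)\<close>, where the scalar polynomial is
    a power with the single root \<rho>.\<close>
  then have "poly (scalar_poly D S X) (T X) = 0"
    using scalar_poly_root_iff[OF alg ms] ext by blast
  then show "X \<in> M \<and> T X = \<rho>"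
    using X \<open>X \<in> M\<close> by (auto simp: abs_univalent_root_def)
next
  assume X: "\<forall>M T. maximal_extension scale D S M T \<longrightarrow> X \<in> M \<and> T X = \<rho>"
  have roots: "poly (scalar_poly D' S' X) e = 0 \<longleftrightarrow> e = \<rho>"
    if ext: "mult_extension scale D S D' S'" for D' S' e
  proof -
    have ms': "mult_summation scale D' S'"
      using ext by (simp add: mult_extension_def)
    note iff = scalar_poly_root_iff[OF alg ms']
    have "e = \<rho>" if e: "poly (scalar_poly D' S' X) e = 0"
    proof -
      obtain D'' S'' where "mult_extension scale D' S' D'' S''" "X \<in> D''" "S'' X = e"
        using e iff by blast
      moreover then obtain M T where "maximal_extension scale D S M T"
        "mult_extension scale D'' S'' M T"
        using maximal_extension_above[OF alg] mult_extension_trans[OF ext] by blast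
      ultimately show ?thesis
        using X unfolding mult_extension_def by metis
    qed
    moreover obtain M T where "maximal_extension scale D S M T" "mult_extension scale D' S' M T"
      using maximal_extension_above[OF alg ext] by blast
    then have "poly (scalar_poly D' S' X) \<rho> = 0"
      using X iff by blast
    ultimately show ?thesis by blast
  qed
  have monic: "lead_coeff (scalar_poly D' S' X) = 1" if ext: "mult_extension scale D S D' S'" for D' S'
  proof -
    \<comment> \<open>The zero polynomial would have both 0 and 1 as roots, whereas \<rho> is the
      only one.\<close>
    have "scalar_poly D' S' X \<noteq> 0"
      using roots[OF ext, of 0] roots[OF ext, of 1] by auto
    then have "annihilators D' S' X \<noteq> {}"
      by (auto simp: scalar_poly_def)
    then show ?thesis
      using scalar_poly_S_minimal ext unfolding mult_extension_def by blast
  qed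
  have pow: "\<exists>m>0. scalar_poly D' S' X = [:- \<rho>, 1:] ^ m"
    if ext: "mult_extension scale D S D' S'" for D' S'
    using poly_single_root[OF monic[OF ext]] roots[OF ext] by blast
  then have "abs_algebraic scale D S X"
    unfolding abs_algebraic_def S_algebraic_def by (auto simp: degree_power_eq dest!: pow)
  then show "abs_univalent_root scale D S X \<rho>"
    unfolding abs_univalent_root_def using pow[OF mult_extension_refl[OF ms]] by blast
qed

section \<open>The univalent extension as the largest canonical extension\<close>

theorem theorem4p7:
  fixes scale :: "'r::comm_ring_1 \<Rightarrow> 'e::alg_closed_field \<Rightarrow> 'e"
    and D :: "'r fps set" and S :: "'r fps \<Rightarrow> 'e"
  assumes "comm_algebra scale"
    and "mult_summation scale D S"
  shows "is_mult_fulfillment scale D S (univalent_dom scale D S) (univalent_sum scale D S)"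
proof -
  note alg = assms(1) and ms = assms(2)
  let ?U = "univalent_dom scale D S" and ?V = "univalent_sum scale D S"
  let ?max = "maximal_extension scale D S"
  note root_iff = abs_univalent_root_iff[OF alg ms]
  \<comment> \<open>One maximal extension is needed to make roots unique: otherwise
    \<open>root_iff\<close> would hold vacuously for every \<rho>.\<close>
  obtain M\<^sub>0 T\<^sub>0 where max0: "?max M\<^sub>0 T\<^sub>0"
    using maximal_extension_exists[OF alg ms] by blast
  \<comment> \<open>Together with \<open>univalentI\<close> this identifies \<open>?U\<close> as the
    set of series where all maximal extensions are defined and agree, with \<open>?V\<close> as the
    common value.\<close>
  have below: "X \<in> M" "T X = ?V X" if "X \<in> ?U" "?max M T" for X M T
  proof -
    obtain \<rho> where \<rho>: "abs_univalent_root scale D S X \<rho>"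
      using \<open>X \<in> ?U\<close> by (auto simp: univalent_dom_def)
    have "\<rho>' = \<rho>" if "abs_univalent_root scale D S X \<rho>'" for \<rho>'
      using \<rho> that max0 by (metis root_iff)
    then have "(THE \<rho>. abs_univalent_root scale D S X \<rho>) = \<rho>"
      using \<rho> by (intro the_equality)
    then have "?V X = \<rho>"
      using \<open>X \<in> ?U\<close> by (simp add: univalent_sum_def)
    then show "X \<in> M" "T X = ?V X"
      using \<rho> \<open>?max M T\<close> root_iff by auto
  qed
  have univalentI: "X \<in> ?U" "?V X = \<rho>" if "\<And>M T. ?max M T \<Longrightarrow> X \<in> M \<and> T X = \<rho>" for X \<rho>
  proof -
    show "X \<in> ?U"
      using that by (auto simp: univalent_dom_def root_iff intro!: exI[of _ \<rho>])
    then show "?V X = \<rho>"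
      using below max0 that by metis
  qed
  have maxD: "mult_extension scale D S M T" "mult_summation scale M T" if "?max M T" for M T
    using that by (auto simp: maximal_extension_def mult_extension_def)
  \<comment> \<open>Used twice: for \<open>(D, S)\<close> itself, which shows that \<open>?U\<close>
    with \<open>?V\<close> is a summation at all, and for arbitrary canonical extensions.\<close>
  have ext: "mult_extension scale D' S' ?U ?V"
    if D': "mult_summation scale D' S'" "\<And>M T. ?max M T \<Longrightarrow> mult_extension scale D' S' M T" for D' S'
  proof (rule mult_extensionI[OF alg D'(1)])
    have *: "X \<in> ?U" "?V X = S' X" if "X \<in> D'" for X
      using univalentI[of X "S' X"] D'(2) that by (auto simp: mult_extension_def)
    then show "D' \<subseteq> ?U" "\<And>x. x \<in> D' \<Longrightarrow> ?V x = S' x"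
      by auto
    show "?V \<in> extensional ?U"
      by (simp add: univalent_sum_def)
    fix x y assume "x \<in> ?U" "y \<in> ?U"
    then have "x + y \<in> M \<and> T (x + y) = ?V x + ?V y" "x * y \<in> M \<and> T (x * y) = ?V x * ?V y"
      if "?max M T" for M T
      using below[OF _ that] mult_summationD[OF maxD(2)[OF that]] by simp_all
    then show "x + y \<in> ?U" "?V (x + y) = ?V x + ?V y" "x * y \<in> ?U" "?V (x * y) = ?V x * ?V y"
      using univalentI by blast+
  qed
  have UV: "mult_extension scale D S ?U ?V"
    using ext[OF ms maxD(1)] .
  have UVM: "mult_extension scale ?U ?V M T" if "?max M T" for M T
    using UV maxD[OF that] below[OF _ that] by (auto simp: mult_extension_def)
  \<comment> \<open>A maximal extension above a given extension also lies above \<open>?U\<close>,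
    so it is a common extension.\<close>
  have can: "mult_canonical scale D S ?U ?V"
    unfolding mult_canonical_def mult_compatible_def
    using UV UVM maximal_extension_above[OF alg] by blast
  \<comment> \<open>A common extension of \<open>(D', S')\<close> and a maximal
    \<open>(M, T)\<close> must equal \<open>(M, T)\<close>, so a canonical extension lies below all
    maximal ones.\<close>
  have top: "mult_extension scale D' S' ?U ?V" if can': "mult_canonical scale D S D' S'" for D' S'
  proof (rule ext)
    show "mult_summation scale D' S'"
      using can' by (simp add: mult_canonical_def mult_extension_def)
    show "mult_extension scale D' S' M T" if "?max M T" for M T
    proof -
      have "mult_compatible scale D' S' M T"
        using can' maxD(1)[OF that] by (simp add: mult_canonical_def)
      then show ?thesis
        using that unfolding mult_compatible_def maximal_extension_def by metis
    qed
  qed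
  \<comment> \<open>Being the greatest canonical extension, \<open>(?U, ?V)\<close> is maximal by
    antisymmetry, and any maximal canonical extension lies below it and so equals it.\<close>
  show ?thesis
    unfolding is_mult_fulfillment_def maximal_mult_canonical_def
    using can top mult_extension_antisym by (metis prod.inject)
qed

end
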